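(* Let $\mathsf{AP}$ be any finite set of atomic propositions. Then $\mathsf{LTL}[\mathsf{AP}]$ admits finite characterizations over $\mathcal{W}^{\mathsf{fin}}$ by (not necessarily simple) schematic examples: for every $\mathsf{LTL}[\mathsf{AP}]$-formula $\varphi$ there is a finite set $E$ of labeled schematic examples such that $\varphi$ fits every element of $E$ and every $\mathsf{LTL}[\mathsf{AP}]$-formula $\psi$ fitting every element of $E$ satisfies $[\![\psi]\!]\cap\mathcal{W}^{\mathsf{fin}}=[\![\varphi]\!]\cap\mathcal{W}^{\mathsf{fin}}$.
   Context: $\mathcal{W}^{\mathsf{fin}}$ is the set of finite words over the alphabet $\Sigma=2^{\mathsf{AP}}$; for $i<|w|$, $w[i..]$ is the suffix starting at position $i$. LTL syntax: $\varphi::=\top\mid p\mid\neg\varphi\mid\varphi\land\varphi\mid\mathsf{X}\varphi\mid\mathsf{F}\varphi\mid\varphi\,\mathsf{U}\,\varphi$ with $p\in\mathsf{AP}$. Semantics on a word $w$: $w\models\top$ always; $w\models p$ iff $p\in w[0]$; $\neg,\land$ as usual; $w\models\mathsf{X}\varphi$ iff $|w|>1$ and $w[1..]\models\varphi$; $w\models\mathsf{F}\varphi$ iff there is $i<|w|$ with $w[i..]\models\varphi$; $w\models\varphi\,\mathsf{U}\,\psi$ iff there is $j<|w|$ with $w[j..]\models\psi$ and $w[i..]\models\varphi$ for all $i<j$. $[\![\varphi]\!]\cap\mathcal{W}^{\mathsf{fin}}$ is the set of finite words satisfying $\varphi$. Schematic examples: let $\mathbb{B}(\mathsf{AP})$ be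 the set of Boolean expressions over $\mathsf{AP}$; each $b\in\mathbb{B}(\mathsf{AP})$ denotes the set of letters $\sigma\in\Sigma$ satisfying it. A schematic example is a union-free regular expression $r$ over the alphabet $\mathbb{B}(\mathsf{AP})$ (built using concatenation and Kleene star, without union), denoting a language $L(r)\subseteq\Sigma^*$; it is simple if its star height is at most 1. $\varphi$ fits the labeled schematic example $(r,+)$ if $L(r)\subseteq[\![\varphi]\!]$, and fits $(r,-)$ if $L(r)\cap[\![\varphi]\!]=\emptyset$. *)

theory Defs
  imports Main
begin

datatype (props: 'a) ltl =
    Top
  | Prop 'a
  | Neg "'a ltl"
  | And "'a ltl" "'a ltl"
  | Next "'a ltl"
  | Finally "'a ltl"
  | Until "'a ltl" "'a ltl"

definition LTL :: "'a set \<Rightarrow> 'a ltl set" where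
  "LTL AP = {\<phi>. props \<phi> \<subseteq> AP}"

text \<open>
  A letter is a set of propositions and the suffix of \<open>w\<close> from position \<open>i\<close> is \<open>drop i w\<close>.
  The empty word counts as a finite word; as it has no first letter, it satisfies no proposition.
\<close>

definition fin_words :: "'a set \<Rightarrow> 'a set list set" where
  "fin_words AP = lists (Pow AP)"

primrec sat :: "'a set list \<Rightarrow> 'a ltl \<Rightarrow> bool" (infix "\<Turnstile>" 50) where
  "w \<Turnstile> Top \<longleftrightarrow> True"
| "w \<Turnstile> Prop p \<longleftrightarrow> 0 < length w \<and> p \<in> w ! 0"
| "w \<Turnstile> Neg \<phi> \<longleftrightarrow> \<not> w \<Turnstile> \<phi>"
| "w \<Turnstile> And \<phi> \<psi> \<longleftrightarrow> w \<Turnstile> \<phi> \<and> w \<Turnstile> \<psi>"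
| "w \<Turnstile> Next \<phi> \<longleftrightarrow> length w > 1 \<and> drop 1 w \<Turnstile> \<phi>"
| "w \<Turnstile> Finally \<phi> \<longleftrightarrow> (\<exists>i<length w. drop i w \<Turnstile> \<phi>)"
| "w \<Turnstile> Until \<phi> \<psi> \<longleftrightarrow>
     (\<exists>j<length w. drop j w \<Turnstile> \<psi> \<and> (\<forall>i<j. drop i w \<Turnstile> \<phi>))"

definition fin_models :: "'a set \<Rightarrow> 'a ltl \<Rightarrow> 'a set list set" where
  "fin_models AP \<phi> = {w \<in> fin_words AP. w \<Turnstile> \<phi>}"

datatype (bprops: 'a) bexp =
    BTrue
  | BFalse
  | BProp 'a
  | BNot "'a bexp"
  | BAnd "'a bexp" "'a bexp"
  | BOr "'a bexp" "'a bexp"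

primrec bsat :: "'a set \<Rightarrow> 'a bexp \<Rightarrow> bool" where
  "bsat \<sigma> BTrue \<longleftrightarrow> True"
| "bsat \<sigma> BFalse \<longleftrightarrow> False"
| "bsat \<sigma> (BProp p) \<longleftrightarrow> p \<in> \<sigma>"
| "bsat \<sigma> (BNot b) \<longleftrightarrow> \<not> bsat \<sigma> b"
| "bsat \<sigma> (BAnd b c) \<longleftrightarrow> bsat \<sigma> b \<and> bsat \<sigma> c"
| "bsat \<sigma> (BOr b c) \<longleftrightarrow> bsat \<sigma> b \<or> bsat \<sigma> c"

definition letters :: "'a set \<Rightarrow> 'a bexp \<Rightarrow> 'a set set" where
  "letters AP b = {\<sigma> \<in> Pow AP. bsat \<sigma> b}"

text \<open>
  Constructors for the empty language and the empty word are not needed: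
  they are denoted by \<open>Symbol BFalse\<close> and \<open>Star (Symbol BFalse)\<close>.
\<close>

datatype (symbols: 'b) union_free_rexp =
    Symbol 'b
  | Conc "'b union_free_rexp" "'b union_free_rexp"
  | Star "'b union_free_rexp"

type_synonym 'a schematic_example = "'a bexp union_free_rexp"

definition schematic_examples :: "'a set \<Rightarrow> 'a schematic_example set" where
  "schematic_examples AP = {r. \<forall>b\<in>symbols r. bprops b \<subseteq> AP}"

primrec lang :: "'a set \<Rightarrow> 'a schematic_example \<Rightarrow> 'a set list set" where
  "lang AP (Symbol b) = {[\<sigma>] |\<sigma>. \<sigma> \<in> letters AP b}"
| "lang AP (Conc r s) = {u @ v |u v. u \<in> lang AP r \<and> v \<in> lang AP s}"
| "lang AP (Star r) = {concat us |us. set us \<subseteq> lang AP r}"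

datatype label = Positive | Negative

definition labeled_examples :: "'a set \<Rightarrow> ('a schematic_example \<times> label) set" where
  "labeled_examples AP = schematic_examples AP \<times> UNIV"

text \<open>
  Schematic examples denote only finite words, so it suffices to consider the finite models
  of a formula.
\<close>

fun fits :: "'a set \<Rightarrow> 'a ltl \<Rightarrow> 'a schematic_example \<times> label \<Rightarrow> bool" where
  "fits AP \<phi> (r, Positive) \<longleftrightarrow> lang AP r \<subseteq> fin_models AP \<phi>"
| "fits AP \<phi> (r, Negative) \<longleftrightarrow> lang AP r \<inter> fin_models AP \<phi> = {}"

end

theory Submission
  imports Defs
begin

text \<open>
  Since \<open>(L \<union> M)\<^sup>* = (L\<^sup>* M\<^sup>*)\<^sup>*\<close> and concatenation distributes over unions, every regular language
  is a finite union of languages of schematic examples. The finite models of \<open>\<phi>\<close> and of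
  \<open>Neg \<phi>\<close> are regular: read from right to left, the set of subformulas of \<open>\<phi>\<close> that hold at
  the current position (together with whether the word is over) is a deterministic finite state.
  Taking the examples covering the models of \<open>\<phi>\<close> as positive and those covering the
  models of \<open>Neg \<phi>\<close> as negative examples leaves no freedom for \<open>\<psi>\<close>.
\<close>

section \<open>Finite unions of schematic examples\<close>

abbreviation conc :: "'b list set \<Rightarrow> 'b list set \<Rightarrow> 'b list set" where
  "conc L M \<equiv> {u @ v |u v. u \<in> L \<and> v \<in> M}"

abbreviation star :: "'b list set \<Rightarrow> 'b list set" where
  "star L \<equiv> {concat us |us. set us \<subseteq> L}"

text \<open>Union is available only outermost, through the finite set \<open>R\<close>, because a
  single example cannot contain one. The closure lemmas show that this class is nevertheless closed
  under concatenation and star.\<close>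

definition schematic_union :: "'a set \<Rightarrow> 'a set list set \<Rightarrow> bool" where
  "schematic_union AP L \<longleftrightarrow>
     (\<exists>R. finite R \<and> R \<subseteq> schematic_examples AP \<and> L = \<Union> (lang AP ` R))"

lemma schematic_unionI:
  assumes "finite R" "R \<subseteq> schematic_examples AP" "L = \<Union> (lang AP ` R)"
  shows "schematic_union AP L"
  using assms unfolding schematic_union_def by blast

lemma schematic_union_lang:
  assumes "r \<in> schematic_examples AP"
  shows "schematic_union AP (lang AP r)"
  using assms by (intro schematic_unionI[of "{r}"]) auto

lemma schematic_union_UN:
  assumes "finite I" "\<And>i. i \<in> I \<Longrightarrow> schematic_union AP (L i)"
  shows "schematic_union AP (\<Union>i\<in>I. L i)"
proof -
  obtain R where R: "\<And>i. i \<in> I \<Longrightarrow> finite (R i) \<and> R i \<subseteq> schematic_examples AP \<and>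
      L i = \<Union> (lang AP ` R i)"
    using assms(2) unfolding schematic_union_def by metis
  show ?thesis
    using R assms(1) by (intro schematic_unionI[of "\<Union>i\<in>I. R i"]) auto
qed

lemma schematic_union_empty: "schematic_union AP {}"
  by (intro schematic_unionI[of "{}"]) auto

lemma schematic_union_Un:
  assumes "schematic_union AP L" "schematic_union AP M"
  shows "schematic_union AP (L \<union> M)"
  using schematic_union_UN[of "{L, M}" AP id] assms by auto

lemma schematic_union_conc:
  assumes "schematic_union AP L" "schematic_union AP M"
  shows "schematic_union AP (conc L M)"
proof -
  obtain R S where R: "finite R" "R \<subseteq> schematic_examples AP" "L = \<Union> (lang AP ` R)"
    and S: "finite S" "S \<subseteq> schematic_examples AP" "M = \<Union> (lang AP ` S)"
    using assms unfolding schematic_union_def by metis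
  have "schematic_union AP (\<Union>(r, s)\<in>R \<times> S. lang AP (Conc r s))"
  proof (rule schematic_union_UN)
    show "finite (R \<times> S)"
      using R(1) S(1) by simp
    fix x assume "x \<in> R \<times> S"
    then obtain r s where x: "x = (r, s)" and "r \<in> R" "s \<in> S"
      by blast
    then have "Conc r s \<in> schematic_examples AP"
      using R(2) S(2) by (auto simp: schematic_examples_def)
    from schematic_union_lang[OF this]
    show "schematic_union AP (case x of (r, s) \<Rightarrow> lang AP (Conc r s))"
      by (simp only: x prod.case)
  qed
  also have "(\<Union>(r, s)\<in>R \<times> S. lang AP (Conc r s)) = conc L M"
    unfolding R(3) S(3) by auto
  finally show ?thesis .
qed

lemma concI: "u \<in> L \<Longrightarrow> v \<in> M \<Longrightarrow> u @ v \<in> conc L M"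
  by blast

lemma concE:
  assumes "w \<in> conc L M"
  obtains u v where "w = u @ v" "u \<in> L" "v \<in> M"
  using assms by blast

section \<open>Closure under Kleene star\<close>

lemma Nil_in_star: "[] \<in> star L"
  by (auto intro: exI[of _ "[]"])

lemma subset_star: "L \<subseteq> star L"
proof
  fix u assume "u \<in> L"
  then show "u \<in> star L"
    by (auto intro!: exI[of _ "[u]"])
qed

lemma star_append:
  assumes "u \<in> star L" "v \<in> star L"
  shows "u @ v \<in> star L"
proof -
  obtain us vs where "u = concat us" "v = concat vs" "set us \<subseteq> L" "set vs \<subseteq> L"
    using assms by auto
  then show ?thesis
    by (auto intro!: exI[of _ "us @ vs"])
qed

lemma star_subset_star:
  assumes "L \<subseteq> star M"
  shows "star L \<subseteq> star M"
proof
  fix u assume "u \<in> star L"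
  then obtain us where us: "u = concat us" "set us \<subseteq> L"
    by auto
  from us(2) have "concat us \<in> star M"
  proof (induction us)
    case Nil
    show ?case
      using Nil_in_star by simp
  next
    case (Cons v us)
    then show ?case
      using star_append[of v M "concat us"] assms by auto
  qed
  then show "u \<in> star M"
    by (simp add: us)
qed

lemma lang_Star_BFalse: "lang AP (Star (Symbol BFalse)) = {[]}"
  by (auto simp: letters_def)

text \<open>The product of the starred members of the list. It replaces their union under an outer
  star, which would not be union-free; nesting the stars is what makes the examples
  non-simple.\<close>

primrec conc_stars :: "'a schematic_example list \<Rightarrow> 'a schematic_example" where
  "conc_stars [] = Star (Symbol BFalse)"
| "conc_stars (r # rs) = Conc (Star r) (conc_stars rs)"

lemma conc_stars_schematic:
  assumes "set rs \<subseteq> schematic_examples AP"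
  shows "conc_stars rs \<in> schematic_examples AP"
  using assms by (induction rs) (auto simp: schematic_examples_def)

lemma append_in_lang_Conc:
  assumes "u \<in> lang AP r" "v \<in> lang AP s"
  shows "u @ v \<in> lang AP (Conc r s)"
  using assms by auto

lemma Nil_in_lang_Star: "[] \<in> lang AP (Star r)"
  using Nil_in_star by simp

lemma Nil_in_conc_stars: "[] \<in> lang AP (conc_stars rs)"
proof (induction rs)
  case Nil
  show ?case
    unfolding conc_stars.simps by (rule Nil_in_lang_Star)
next
  case (Cons r rs)
  then show ?case
    using append_in_lang_Conc[OF Nil_in_lang_Star Cons] by simp
qed

text \<open>The factor \<open>Star r\<close> produces the word and every other factor contributes
  the empty word.\<close>

lemma lang_subset_conc_stars:
  assumes "r \<in> set rs"
  shows "lang AP r \<subseteq> lang AP (conc_stars rs)"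
  using assms
proof (induction rs)
  case Nil
  then show ?case by simp
next
  case (Cons s rs)
  show ?case
  proof
    fix u assume u: "u \<in> lang AP r"
    show "u \<in> lang AP (conc_stars (s # rs))"
    proof (cases "r = s")
      case True
      then have "u \<in> lang AP (Star s)"
        using u subset_star by auto
      then have "u @ [] \<in> lang AP (Conc (Star s) (conc_stars rs))"
        using Nil_in_conc_stars by (rule append_in_lang_Conc)
      then show ?thesis by simp
    next
      case False
      then have "u \<in> lang AP (conc_stars rs)"
        using Cons u by auto
      with Nil_in_lang_Star have "[] @ u \<in> lang AP (Conc (Star s) (conc_stars rs))"
        by (rule append_in_lang_Conc)
      then show ?thesis by simp
    qed
  qed
qed

lemma conc_stars_subset_star:
  "lang AP (conc_stars rs) \<subseteq> star (\<Union> (lang AP ` set rs))"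
proof (induction rs)
  case Nil
  show ?case
    unfolding conc_stars.simps lang_Star_BFalse using Nil_in_star by auto
next
  case (Cons r rs)
  let ?M = "\<Union> (lang AP ` set (r # rs))"
  have "lang AP (Star r) \<subseteq> star ?M"
    unfolding lang.simps(3) using subset_star[of ?M] by (intro star_subset_star) auto
  moreover have "lang AP (conc_stars rs) \<subseteq> star ?M"
    using Cons subset_star[of ?M] star_subset_star[of "\<Union> (lang AP ` set rs)" ?M] by auto
  ultimately have "u @ v \<in> star ?M"
    if "u \<in> lang AP (Star r)" "v \<in> lang AP (conc_stars rs)" for u v
    using that by (intro star_append) (erule subsetD, assumption)+
  then show ?case
    unfolding conc_stars.simps lang.simps(2) by (auto simp del: lang.simps)
qed

text \<open>The language of \<open>conc_stars rs\<close> lies between \<open>L\<close> and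
  \<open>star L\<close>, so its star is \<open>star L\<close>.\<close>

lemma schematic_union_star:
  assumes "schematic_union AP L"
  shows "schematic_union AP (star L)"
proof -
  obtain R where R: "finite R" "R \<subseteq> schematic_examples AP" "L = \<Union> (lang AP ` R)"
    using assms unfolding schematic_union_def by metis
  obtain rs where rs: "set rs = R"
    using finite_list[OF R(1)] by blast
  have "star L = star (lang AP (conc_stars rs))"
  proof
    have "L \<subseteq> lang AP (conc_stars rs)"
      using R(3) rs lang_subset_conc_stars by fast
    then show "star L \<subseteq> star (lang AP (conc_stars rs))"
      by blast
    show "star (lang AP (conc_stars rs)) \<subseteq> star L"
      using conc_stars_subset_star[of AP rs] by (intro star_subset_star) (simp add: R(3) rs)
  qed
  moreover have "Star (conc_stars rs) \<in> schematic_examples AP"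
    using conc_stars_schematic[of rs AP] R(2) rs by (simp add: schematic_examples_def)
  ultimately show ?thesis
    using schematic_union_lang[of "Star (conc_stars rs)" AP] by simp
qed

section \<open>The empty word and single letters\<close>

lemma schematic_union_Nil: "schematic_union AP {[]}"
  using schematic_union_lang[of "Star (Symbol BFalse)" AP, unfolded lang_Star_BFalse]
  by (simp add: schematic_examples_def)

text \<open>The expression is the minterm of the letter: the conjunction over \<open>a\<close> in
  \<open>A\<close> of \<open>a\<close> or its negation. It cannot see propositions outside
  \<open>A\<close>, hence the intersections.\<close>

lemma bexp_for_letter:
  assumes "finite A"
  obtains b where "bprops b \<subseteq> A" "\<And>\<tau>. bsat \<tau> b \<longleftrightarrow> \<tau> \<inter> A = \<sigma> \<inter> A"
proof -
  from assms have "\<exists>b. bprops b \<subseteq> A \<and> (\<forall>\<tau>. bsat \<tau> b \<longleftrightarrow> \<tau> \<inter> A = \<sigma> \<inter> A)"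
  proof induction
    case empty
    show ?case
      by (intro exI[of _ BTrue]) auto
  next
    case (insert a A)
    then obtain b where "bprops b \<subseteq> A" "\<And>\<tau>. bsat \<tau> b \<longleftrightarrow> \<tau> \<inter> A = \<sigma> \<inter> A"
      by blast
    then show ?case
      using insert(2)
      by (intro exI[of _ "BAnd (if a \<in> \<sigma> then BProp a else BNot (BProp a)) b"]) auto
  qed
  then show ?thesis
    using that by blast
qed

lemma schematic_union_letter:
  assumes "finite AP" "\<sigma> \<in> Pow AP"
  shows "schematic_union AP {[\<sigma>]}"
proof -
  obtain b where b: "bprops b \<subseteq> AP" "\<And>\<tau>. bsat \<tau> b \<longleftrightarrow> \<tau> \<inter> AP = \<sigma> \<inter> AP"
    using bexp_for_letter[OF assms(1)] by blast
  then have "letters AP b = {\<sigma>}"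
    using assms(2) by (auto simp: letters_def)
  then show ?thesis
    using schematic_union_lang[of "Symbol b" AP] b(1) by (simp add: schematic_examples_def)
qed

section \<open>Automata reading from right to left\<close>

text \<open>
  \<open>path \<Sigma> \<delta> q K p u\<close> means that reading \<open>u\<close> from right to left leads from \<open>q\<close> to \<open>p\<close>
  with all intermediate states in \<open>K\<close>.
\<close>

inductive path :: "'b set \<Rightarrow> ('b \<Rightarrow> 's \<Rightarrow> 's) \<Rightarrow> 's \<Rightarrow> 's set \<Rightarrow> 's \<Rightarrow> 'b list \<Rightarrow> bool"
  for \<Sigma> \<delta> q K where
  Nil: "path \<Sigma> \<delta> q K q []"
| Cons: "\<lbrakk>path \<Sigma> \<delta> q K s u; u = [] \<or> s \<in> K; \<sigma> \<in> \<Sigma>\<rbrakk> \<Longrightarrow> path \<Sigma> \<delta> q K (\<delta> \<sigma> s) (\<sigma> # u)"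

lemma path_singleton: "\<sigma> \<in> \<Sigma> \<Longrightarrow> \<delta> \<sigma> q = p \<Longrightarrow> path \<Sigma> \<delta> q K p [\<sigma>]"
  using path.Cons path.Nil by fastforce

lemma path_Nil_iff: "path \<Sigma> \<delta> q K p [] \<longleftrightarrow> p = q"
  by (auto intro: path.Nil elim: path.cases)

lemma path_mono:
  assumes "path \<Sigma> \<delta> q K p u" "K \<subseteq> K'"
  shows "path \<Sigma> \<delta> q K' p u"
  using assms by induction (auto intro: path.intros)

text \<open>The right part \<open>v\<close> is read first. The state \<open>k\<close> where the two
  runs meet may become an intermediate one, which is why it must lie in \<open>K\<close>.\<close>

lemma path_append:
  assumes "path \<Sigma> \<delta> k K p u" "path \<Sigma> \<delta> q K k v" "k \<in> K"
  shows "path \<Sigma> \<delta> q K p (u @ v)"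
  using assms
proof induction
  case Nil
  then show ?case by simp
next
  case (Cons s u \<sigma>)
  then have "s \<in> K"
    by (auto simp: path_Nil_iff)
  with Cons show ?case
    by (auto intro: path.Cons)
qed

text \<open>Without intermediate states at most one letter can be read.\<close>

lemma path_empty:
  "{u. path \<Sigma> \<delta> q {} p u} =
     (if p = q then {[]} else {}) \<union> (\<Union>\<sigma>\<in>{\<sigma> \<in> \<Sigma>. \<delta> \<sigma> q = p}. {[\<sigma>]})"
  (is "_ = ?R")
proof
  show "{u. path \<Sigma> \<delta> q {} p u} \<subseteq> ?R"
    by (auto simp: path_Nil_iff elim: path.cases)
  show "?R \<subseteq> {u. path \<Sigma> \<delta> q {} p u}"
    by (auto simp: path_Nil_iff intro: path_singleton)
qed

text \<open>Kleene's decomposition at visits to \<open>k\<close>, in reversed order: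
  \<open>c\<close> is read first and reaches \<open>k\<close>, \<open>b\<close> is a sequence of
  loops at \<open>k\<close>, and \<open>a\<close> leads from \<open>k\<close> to \<open>p\<close>.
  The induction adds the letter read last, at the left end.\<close>

lemma path_insert_split:
  assumes "path \<Sigma> \<delta> q (insert k K) p u"
  shows "path \<Sigma> \<delta> q K p u \<or>
    (\<exists>a b c. u = a @ b @ c \<and> path \<Sigma> \<delta> k K p a \<and> b \<in> star {w. path \<Sigma> \<delta> k K k w} \<and>
       path \<Sigma> \<delta> q K k c)"
  using assms
proof induction
  case Nil
  show ?case
    by (simp add: path.Nil)
next
  case (Cons s u \<sigma>)
  let ?S = "star {w. path \<Sigma> \<delta> k K k w}"
  have splitI: ?case if "\<sigma> # u = a @ b @ c" "path \<Sigma> \<delta> k K (\<delta> \<sigma> s) a" "b \<in> ?S"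
    "path \<Sigma> \<delta> q K k c" for a b c
    by (intro disjI2 exI conjI) (rule that)+
  from Cons.IH show ?case
  proof (elim disjE exE conjE)
    assume u: "path \<Sigma> \<delta> q K s u"
    show ?thesis
    proof (cases "u = [] \<or> s \<in> K")
      case True
      then show ?thesis
        using u Cons.hyps by (auto intro: path.Cons)
    next
      case False
      \<comment> \<open>The run so far, which avoids \<open>k\<close> as a new intermediate state,
        ends in \<open>k\<close>: all of \<open>u\<close> becomes \<open>c\<close>, and the new
        letter starts \<open>a\<close>.\<close>
      then have "s = k"
        using Cons.hyps by simp
      show ?thesis
      proof (rule splitI)
        show "\<sigma> # u = [\<sigma>] @ [] @ u"
          by simp
        show "path \<Sigma> \<delta> k K (\<delta> \<sigma> s) [\<sigma>]"
          using Cons.hyps(3) \<open>s = k\<close> by (simp add: path_singleton)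
        show "[] \<in> ?S"
          by (rule Nil_in_star)
        show "path \<Sigma> \<delta> q K k u"
          using u \<open>s = k\<close> by simp
      qed
    qed
  next
    fix a b c
    assume u: "u = a @ b @ c" and a: "path \<Sigma> \<delta> k K s a" and b: "b \<in> ?S"
      and c: "path \<Sigma> \<delta> q K k c"
    show ?thesis
    proof (cases "s = k")
      case True
      \<comment> \<open>The segment \<open>a\<close> has returned to \<open>k\<close>, so it joins
        the loops and the new letter starts a fresh segment.\<close>
      show ?thesis
      proof (rule splitI)
        show "\<sigma> # u = [\<sigma>] @ (a @ b) @ c"
          by (simp add: u)
        show "path \<Sigma> \<delta> k K (\<delta> \<sigma> s) [\<sigma>]"
          using Cons.hyps(3) True by (simp add: path_singleton)
        have "a \<in> {w. path \<Sigma> \<delta> k K k w}"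
          using a True by simp
        then show "a @ b \<in> ?S"
          by (intro star_append b subsetD[OF subset_star])
        show "path \<Sigma> \<delta> q K k c"
          by (rule c)
      qed
    next
      case False
      \<comment> \<open>If \<open>u\<close> were empty, so would be \<open>a\<close>, which would
        force \<open>s = k\<close>.\<close>
      then have "s \<in> K"
        using Cons.hyps(2) a u by (auto simp: path_Nil_iff)
      then have "path \<Sigma> \<delta> k K (\<delta> \<sigma> s) (\<sigma> # a)"
        using a Cons.hyps(3) by (auto intro: path.Cons)
      moreover have "\<sigma> # u = (\<sigma> # a) @ b @ c"
        by (simp add: u)
      ultimately show ?thesis
        using b c by (intro splitI)
    qed
  qed
qed

lemma path_star:
  assumes "k \<in> K" "b \<in> star {w. path \<Sigma> \<delta> k K k w}"
  shows "path \<Sigma> \<delta> k K k b"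
proof -
  obtain us where us: "b = concat us" "\<forall>w\<in>set us. path \<Sigma> \<delta> k K k w"
    using assms(2) by auto
  from us(2) have "path \<Sigma> \<delta> k K k (concat us)"
    by (induction us) (auto intro: path.Nil path_append assms(1))
  then show ?thesis
    by (simp add: us)
qed

lemma path_insert:
  "{u. path \<Sigma> \<delta> q (insert k K) p u} =
     {u. path \<Sigma> \<delta> q K p u} \<union>
     conc {u. path \<Sigma> \<delta> k K p u}
       (conc (star {u. path \<Sigma> \<delta> k K k u}) {u. path \<Sigma> \<delta> q K k u})"
  (is "?L = ?P \<union> conc ?A (conc ?B ?C)")
proof (intro equalityI subsetI)
  fix u assume "u \<in> ?L"
  then have "path \<Sigma> \<delta> q (insert k K) p u"
    by simp
  from path_insert_split[OF this] show "u \<in> ?P \<union> conc ?A (conc ?B ?C)"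
  proof (elim disjE exE conjE)
    assume "path \<Sigma> \<delta> q K p u"
    then show ?thesis
      by simp
  next
    fix a b c
    assume u: "u = a @ b @ c" and b: "b \<in> ?B"
      and "path \<Sigma> \<delta> k K p a" "path \<Sigma> \<delta> q K k c"
    then have "a \<in> ?A" "c \<in> ?C"
      by simp_all
    with b show ?thesis
      unfolding u by (intro UnI2 concI)
  qed
next
  have mono: "path \<Sigma> \<delta> q' (insert k K) p' u" if "path \<Sigma> \<delta> q' K p' u" for q' p' u
    using that by (rule path_mono) auto
  fix u assume "u \<in> ?P \<union> conc ?A (conc ?B ?C)"
  then show "u \<in> ?L"
  proof
    assume "u \<in> ?P"
    then show ?thesis
      by (simp add: mono)
  next
    assume "u \<in> conc ?A (conc ?B ?C)"
    then obtain a v where u: "u = a @ v" and a: "a \<in> ?A" and "v \<in> conc ?B ?C"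
      by (rule concE)
    then obtain b c where v: "v = b @ c" and b: "b \<in> ?B" and c: "c \<in> ?C"
      by - (rule concE)
    \<comment> \<open>\<open>path_star\<close> needs \<open>k\<close> among the allowed intermediate
      states, so the loops are first viewed as paths through \<open>insert k K\<close>.\<close>
    have "{w. path \<Sigma> \<delta> k K k w} \<subseteq> {w. path \<Sigma> \<delta> k (insert k K) k w}"
      by (simp add: Collect_mono mono)
    then have "?B \<subseteq> star {w. path \<Sigma> \<delta> k (insert k K) k w}"
      by (intro star_subset_star order.trans[OF _ subset_star])
    then have "path \<Sigma> \<delta> k (insert k K) k b"
      using b by (intro path_star) (simp, rule subsetD)
    moreover have "path \<Sigma> \<delta> q (insert k K) k c"
      using c by (simp add: mono)
    ultimately have "path \<Sigma> \<delta> q (insert k K) k (b @ c)"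
      by (rule path_append) simp
    moreover have "path \<Sigma> \<delta> k (insert k K) p a"
      using a by (simp add: mono)
    ultimately have "path \<Sigma> \<delta> q (insert k K) p u"
      unfolding u v by (intro path_append[of _ _ k _ p a]) simp_all
    then show ?thesis
      by simp
  qed
qed

text \<open>Kleene's theorem, by induction on the allowed intermediate states. The end points vary
  because \<open>path_insert\<close> refers to paths from and to \<open>k\<close>.\<close>

lemma schematic_union_path:
  assumes "finite AP" "finite K"
  shows "schematic_union AP {u. path (Pow AP) \<delta> q K p u}"
  using assms(2)
proof (induction K arbitrary: q p)
  case empty
  have "schematic_union AP (\<Union>\<sigma>\<in>{\<sigma> \<in> Pow AP. \<delta> \<sigma> q = p}. {[\<sigma>]})"
    using assms(1) by (intro schematic_union_UN schematic_union_letter) auto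
  then show ?case
    unfolding path_empty
    by (intro schematic_union_Un) (auto simp: schematic_union_Nil schematic_union_empty)
next
  case (insert k K)
  then show ?case
    unfolding path_insert
    by (intro schematic_union_Un schematic_union_conc schematic_union_star)
qed

text \<open>A Myhill-Nerode argument: \<open>T\<close> has finitely many values and is compatible
  with prepending letters, so its values are the states of a finite automaton reading from the
  right.\<close>

lemma schematic_union_congruence:
  fixes T :: "'a set list \<Rightarrow> 's"
  assumes "finite AP" "finite (range T)"
    and cong: "\<And>\<sigma> w w'. T w = T w' \<Longrightarrow> T (\<sigma> # w) = T (\<sigma> # w')"
  shows "schematic_union AP {w \<in> fin_words AP. T w \<in> F}"
proof -
  \<comment> \<open>The letter is prepended to an arbitrary representative of the state;
    \<open>cong\<close> makes the result independent of the choice.\<close>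
  define \<delta> where "\<delta> \<sigma> s = T (\<sigma> # (SOME w. T w = s))" for \<sigma> s
  have \<delta>: "\<delta> \<sigma> (T w) = T (\<sigma> # w)" for \<sigma> w
    unfolding \<delta>_def by (rule cong) (rule someI[of _ w], rule refl)
  \<comment> \<open>All states reached lie in \<open>range T\<close>, so allowing exactly these as
    intermediate states excludes no run.\<close>
  have "path (Pow AP) \<delta> (T []) (range T) (T w) w" if "w \<in> fin_words AP" for w
    using that
  proof (induction w)
    case Nil
    show ?case
      by (rule path.Nil)
  next
    case (Cons \<sigma> w)
    then have "path (Pow AP) \<delta> (T []) (range T) (\<delta> \<sigma> (T w)) (\<sigma> # w)"
      by (intro path.Cons) (auto simp: fin_words_def)
    then show ?case
      by (simp add: \<delta>)
  qed
  moreover have "w \<in> fin_words AP \<and> T w = p" if "path (Pow AP) \<delta> (T []) (range T) p w" for p w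
    using that by induction (auto simp: fin_words_def \<delta>)
  ultimately have "path (Pow AP) \<delta> (T []) (range T) p w \<longleftrightarrow> w \<in> fin_words AP \<and> T w = p" for p w
    by metis
  \<comment> \<open>Intersecting with \<open>range T\<close> makes the union finite even if
    \<open>F\<close> is infinite.\<close>
  then have "{w \<in> fin_words AP. T w \<in> F} =
      (\<Union>p\<in>F \<inter> range T. {w. path (Pow AP) \<delta> (T []) (range T) p w})"
    by auto
  also have "schematic_union AP \<dots>"
    using assms(1,2) by (intro schematic_union_UN schematic_union_path) auto
  finally show ?thesis .
qed

section \<open>Models of LTL formulas\<close>

primrec subformulas :: "'a ltl \<Rightarrow> 'a ltl set" where
  "subformulas Top = {Top}"
| "subformulas (Prop p) = {Prop p}"
| "subformulas (Neg \<phi>) = insert (Neg \<phi>) (subformulas \<phi>)"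
| "subformulas (And \<phi> \<psi>) = insert (And \<phi> \<psi>) (subformulas \<phi> \<union> subformulas \<psi>)"
| "subformulas (Next \<phi>) = insert (Next \<phi>) (subformulas \<phi>)"
| "subformulas (Finally \<phi>) = insert (Finally \<phi>) (subformulas \<phi>)"
| "subformulas (Until \<phi> \<psi>) = insert (Until \<phi> \<psi>) (subformulas \<phi> \<union> subformulas \<psi>)"

lemma finite_subformulas: "finite (subformulas \<phi>)"
  by (induction \<phi>) auto

lemma self_in_subformulas: "\<phi> \<in> subformulas \<phi>"
  by (cases \<phi>) auto

lemma sat_Next_Cons: "\<sigma> # w \<Turnstile> Next \<phi> \<longleftrightarrow> w \<noteq> [] \<and> w \<Turnstile> \<phi>"
  by simp

lemma sat_Finally_Cons: "\<sigma> # w \<Turnstile> Finally \<phi> \<longleftrightarrow> \<sigma> # w \<Turnstile> \<phi> \<or> w \<Turnstile> Finally \<phi>"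
  by (simp add: Ex_less_Suc2)

text \<open>The witness is position 0 or lies in \<open>w\<close>. This also covers empty
  \<open>w\<close>, where \<open>Until\<close> fails for lack of a position.\<close>

lemma sat_Until_Cons:
  "\<sigma> # w \<Turnstile> Until \<phi> \<psi> \<longleftrightarrow> \<sigma> # w \<Turnstile> \<psi> \<or> \<sigma> # w \<Turnstile> \<phi> \<and> w \<Turnstile> Until \<phi> \<psi>"
  by (auto simp add: Ex_less_Suc2 All_less_Suc2)

text \<open>By the expansion laws, truth at \<open>\<sigma> # w\<close> is determined by the letter,
  the truth of the subformulas at \<open>w\<close>, and, for \<open>Next\<close>, whether
  \<open>w\<close> is empty.\<close>

lemma sat_Cons_cong:
  assumes "w = [] \<longleftrightarrow> w' = []" "\<forall>\<chi>\<in>subformulas \<phi>. w \<Turnstile> \<chi> \<longleftrightarrow> w' \<Turnstile> \<chi>"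
  shows "\<forall>\<chi>\<in>subformulas \<phi>. \<sigma> # w \<Turnstile> \<chi> \<longleftrightarrow> \<sigma> # w' \<Turnstile> \<chi>"
  using assms(2)
proof (induction \<phi>)
  case (Next \<phi>)
  then show ?case
    using assms(1) self_in_subformulas[of \<phi>]
    by (simp add: sat_Next_Cons del: sat.simps(5))
next
  case (Finally \<phi>)
  then show ?case
    using self_in_subformulas[of \<phi>] by (simp add: sat_Finally_Cons del: sat.simps(6))
next
  case (Until \<phi> \<psi>)
  then show ?case
    using self_in_subformulas[of \<phi>] self_in_subformulas[of \<psi>]
    by (auto simp add: sat_Until_Cons simp del: sat.simps(7))
qed (auto simp: self_in_subformulas)

lemma schematic_union_fin_models:
  assumes "finite AP"
  shows "schematic_union AP (fin_models AP \<phi>)"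
proof -
  \<comment> \<open>Emptiness is recorded separately since the subformulas need not reveal it: those
    of \<open>Next Top\<close> have the same truth values on the empty word and on a one-letter
    word.\<close>
  define T where "T w = (w = [], {\<chi> \<in> subformulas \<phi>. w \<Turnstile> \<chi>})" for w
  have cong: "T (\<sigma> # w) = T (\<sigma> # w')" if "T w = T w'" for \<sigma> w w'
  proof -
    have "w = [] \<longleftrightarrow> w' = []" and "\<forall>\<chi>\<in>subformulas \<phi>. w \<Turnstile> \<chi> \<longleftrightarrow> w' \<Turnstile> \<chi>"
      using that by (auto simp: T_def)
    from sat_Cons_cong[OF this, of \<sigma>] show ?thesis
      by (auto simp: T_def)
  qed
  have "finite (range T)"
    by (rule finite_subset[of _ "UNIV \<times> Pow (subformulas \<phi>)"])
      (auto simp: T_def finite_subformulas)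
  from schematic_union_congruence[OF assms this cong]
  have "schematic_union AP {w \<in> fin_words AP. T w \<in> {s. \<phi> \<in> snd s}}" .
  moreover have "{w \<in> fin_words AP. T w \<in> {s. \<phi> \<in> snd s}} = fin_models AP \<phi>"
    by (auto simp: T_def fin_models_def self_in_subformulas)
  ultimately show ?thesis
    by simp
qed

section \<open>From regular model sets to characterizing examples\<close>

theorem theorem26:
  fixes AP :: "'a set"
  assumes "finite AP"
  shows "\<forall>\<phi> \<in> LTL AP. \<exists>E. finite E \<and> E \<subseteq> labeled_examples AP \<and>
           (\<forall>e\<in>E. fits AP \<phi> e) \<and>
           (\<forall>\<psi> \<in> LTL AP. (\<forall>e\<in>E. fits AP \<psi> e) \<longrightarrow> fin_models AP \<psi> = fin_models AP \<phi>)"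
proof
  fix \<phi> :: "'a ltl"
  obtain P where P: "finite P" "P \<subseteq> schematic_examples AP" "fin_models AP \<phi> = \<Union> (lang AP ` P)"
    using schematic_union_fin_models[OF assms, of \<phi>] unfolding schematic_union_def by blast
  obtain N where N: "finite N" "N \<subseteq> schematic_examples AP"
      "fin_models AP (Neg \<phi>) = \<Union> (lang AP ` N)"
    using schematic_union_fin_models[OF assms, of "Neg \<phi>"] unfolding schematic_union_def by blast
  have Neg: "fin_models AP (Neg \<phi>) = fin_words AP - fin_models AP \<phi>"
    by (auto simp: fin_models_def)
  let ?E = "P \<times> {Positive} \<union> N \<times> {Negative}"
  have fits_iff: "(\<forall>e\<in>?E. fits AP \<psi> e) \<longleftrightarrow>
      fin_models AP \<phi> \<subseteq> fin_models AP \<psi> \<and> fin_models AP (Neg \<phi>) \<inter> fin_models AP \<psi> = {}" for \<psi>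
    unfolding P(3) N(3) by (auto simp: ball_Un)
  have models: "fin_models AP \<psi> \<subseteq> fin_words AP" for \<psi>
    by (auto simp: fin_models_def)
  show "\<exists>E. finite E \<and> E \<subseteq> labeled_examples AP \<and> (\<forall>e\<in>E. fits AP \<phi> e) \<and>
      (\<forall>\<psi> \<in> LTL AP. (\<forall>e\<in>E. fits AP \<psi> e) \<longrightarrow> fin_models AP \<psi> = fin_models AP \<phi>)"
  proof (intro exI[of _ ?E] conjI)
    show "finite ?E"
      using P(1) N(1) by simp
    show "?E \<subseteq> labeled_examples AP"
      using P(2) N(2) by (auto simp: labeled_examples_def)
    show "\<forall>e\<in>?E. fits AP \<phi> e"
      unfolding fits_iff Neg by blast
    \<comment> \<open>The models of \<open>\<psi>\<close> contain those of \<open>\<phi>\<close> and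
      avoid their complement in \<open>fin_words AP\<close>.\<close>
    show "\<forall>\<psi> \<in> LTL AP. (\<forall>e\<in>?E. fits AP \<psi> e) \<longrightarrow> fin_models AP \<psi> = fin_models AP \<phi>"
      unfolding fits_iff Neg using models by blast
  qed
qed

end
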